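(* Let $\rho$, $p$ be smooth scalar fields and $\vec u$, $\vec f$ smooth vector fields (functions of space and time) satisfying the modified continuity equation $$\frac{\partial\rho}{\partial t}+\nabla\cdot(\rho\vec u)=\nabla\cdot\vec f$$ and the modified inviscid momentum equation $$\frac{\partial(\rho\vec u)}{\partial t}+\nabla\cdot\{(\rho\vec u)\otimes\vec u+p\,I\}=\nabla\cdot(\vec f\otimes\vec u).$$ Then the specific kinetic energy $k=\tfrac12\,\vec u\cdot\vec u$ satisfies $$\frac{\partial(\rho k)}{\partial t}+\nabla\cdot(\rho\vec uk)+\nabla\cdot(\vec up)-p(\nabla\cdot\vec u)=\nabla\cdot(\vec fk),$$ so that the regularization flux $\vec f$ contributes to the kinetic energy only through a term in conservative (divergence) form.
   Context: $\rho$ is the total density of a two-phase mixture, $\vec u$ the velocity, $p$ the pressure, and $\vec f=\sum_{l=1}^2\rho_{0l}\vec a_l$ the net mass-regularization flux, where $\rho_{0l}$ are constants (characteristic densities), $\vec a_1=\Gamma\{\epsilon\nabla\phi_1-\phi_1(1-\phi_1)\nabla\phi_1/|\nabla\phi_1|\}$ is the interface-regularization flux for the volume fraction $\phi_1$ of phase 1, $\Gamma,\epsilon$ are the interface parameters, and $\vec a_2=-\vec a_1$. $I$ is the identity tensor; in index notation $(\nabla\cdot(\vec f\otimes\vec u))_j=\sum_i\partial_i(f_iu_j)$, and similarly for the other tensor products. *)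

theory Defs
  imports "HOL-Analysis.Analysis"
begin

(* Continuous differentiability of order n, by recursion on directional derivatives.
   Meant for open S: "at x" is the unrestricted neighbourhood filter. *)
primrec C_diff_on ::
  "nat \<Rightarrow> 'a::euclidean_space set \<Rightarrow> ('a \<Rightarrow> 'b::real_normed_vector) \<Rightarrow> bool" where
  "C_diff_on 0 S g \<longleftrightarrow> continuous_on S g"
| "C_diff_on (Suc n) S g \<longleftrightarrow>
     (\<forall>x\<in>S. g differentiable (at x)) \<and>
     (\<forall>v. C_diff_on n S (\<lambda>x. frechet_derivative g (at x) v))"

definition smooth_on ::
  "'a::euclidean_space set \<Rightarrow> ('a \<Rightarrow> 'b::real_normed_vector) \<Rightarrow> bool" where
  "smooth_on S g \<longleftrightarrow> (\<forall>n. C_diff_on n S g)"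

definition partial_deriv :: "'n::finite \<Rightarrow> (real^'n \<Rightarrow> real) \<Rightarrow> real^'n \<Rightarrow> real" where
  "partial_deriv i g x = frechet_derivative g (at x) (axis i 1)"

definition divergence :: "(real^'n \<Rightarrow> real^'n) \<Rightarrow> real^'n \<Rightarrow> real" where
  "divergence V x = (\<Sum>i\<in>UNIV. partial_deriv i (\<lambda>y. V y $ i) x)"

(* The contraction is with the first index of the tensor. *)
definition tensor_divergence :: "(real^'n \<Rightarrow> real^'n^'n) \<Rightarrow> real^'n \<Rightarrow> real^'n" where
  "tensor_divergence T x = (\<chi> j. \<Sum>i\<in>UNIV. partial_deriv i (\<lambda>y. T y $ i $ j) x)"

definition tensor_product :: "real^'n \<Rightarrow> real^'n \<Rightarrow> real^'n^'n" where
  "tensor_product a b = (\<chi> i j. a $ i * b $ j)"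

definition specific_kinetic_energy :: "real^'n \<Rightarrow> real" where
  "specific_kinetic_energy v = 1 / 2 * (v \<bullet> v)"

end

(* Subtracting u_j times the continuity equation from the j-th momentum equation leaves the
   non-conservative form
     rho * d_t u_j + sum_i rho * u_i * d_i u_j + d_j p = sum_i f_i * d_i u_j,
   in which div f no longer occurs.  Contracting with u and adding k times the continuity equation
   puts all terms back into divergence form, since d k = sum_j u_j * d u_j. *)

theory Submission
  imports Defs
begin

lemma smooth_on_imp_differentiable:
  assumes "smooth_on S g" "x \<in> S"
  shows "g differentiable (at x)"
proof -
  have "C_diff_on (Suc 0) S g"
    using assms(1) unfolding smooth_on_def by blast
  then show ?thesis using assms(2) by simp
qed

text \<open>Smoothness is assumed jointly in time and space, whereas \<open>partial_deriv\<close>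
  acts at a frozen time. The chain rule with the embedding of a time slice bridges the two; the
  companion lemma below does the same for the time derivatives.\<close>

lemma differentiable_section_snd:
  assumes "(\<lambda>(t, x). g t x) differentiable (at (t, x))"
  shows "(\<lambda>y. g t y) differentiable (at x)"
proof -
  have "((\<lambda>(t, x). g t x) \<circ> (\<lambda>y. (t, y))) differentiable (at x)"
    using assms
    by (intro differentiable_chain_at differentiable_Pair) simp_all
  then show ?thesis by (simp add: o_def)
qed

lemma differentiable_section_fst:
  assumes "(\<lambda>(t, x). g t x) differentiable (at (t, x))"
  shows "(\<lambda>s. g s x) differentiable (at t)"
proof -
  have "((\<lambda>(t, x). g t x) \<circ> (\<lambda>s. (s, x))) differentiable (at t)"
    using assms
    by (intro differentiable_chain_at differentiable_Pair) simp_all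
  then show ?thesis by (simp add: o_def)
qed

lemma differentiable_vec_nth:
  fixes V :: "'a::real_normed_vector \<Rightarrow> real^'n"
  assumes "V differentiable F"
  shows "(\<lambda>y. V y $ i) differentiable F"
  using assms bounded_linear.has_derivative[OF bounded_linear_vec_nth]
  unfolding differentiable_def by blast

lemma partial_deriv_eqI:
  assumes "(g has_derivative g') (at x)"
  shows "partial_deriv i g x = g' (axis i 1)"
  using frechet_derivative_at[OF assms] by (simp add: partial_deriv_def)

lemma partial_deriv_add:
  assumes "g differentiable (at x)" "h differentiable (at x)"
  shows "partial_deriv i (\<lambda>y. g y + h y) x = partial_deriv i g x + partial_deriv i h x"
  using partial_deriv_eqI[OF has_derivative_add] assms
  by (simp add: frechet_derivative_works partial_deriv_def)

lemma partial_deriv_mult: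
  assumes "g differentiable (at x)" "h differentiable (at x)"
  shows "partial_deriv i (\<lambda>y. g y * h y) x
    = g x * partial_deriv i h x + partial_deriv i g x * h x"
  using partial_deriv_eqI[OF has_derivative_mult] assms
  by (simp add: frechet_derivative_works partial_deriv_def)

lemma partial_deriv_const: "partial_deriv i (\<lambda>y. c) x = 0"
  by (rule partial_deriv_eqI) simp

text \<open>The product rule yields the same inner product twice, by symmetry, which cancels the
  factor 1/2. The domain of \<open>u\<close> is left general so that the lemma covers
  differentiation both in time and in space.\<close>

lemma has_derivative_specific_kinetic_energy:
  assumes "(u has_derivative u') (at x)"
  shows "((\<lambda>y. specific_kinetic_energy (u y)) has_derivative (\<lambda>h. u x \<bullet> u' h)) (at x)"
  unfolding specific_kinetic_energy_def
  by (rule has_derivative_eq_rhs, (rule derivative_intros assms)+)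
    (simp add: fun_eq_iff inner_commute)

lemma partial_deriv_specific_kinetic_energy:
  assumes "u differentiable (at x)"
  shows "partial_deriv i (\<lambda>y. specific_kinetic_energy (u y)) x
    = (\<Sum>j\<in>UNIV. u x $ j * partial_deriv i (\<lambda>y. u y $ j) x)"
proof -
  obtain u' where u': "(u has_derivative u') (at x)"
    using assms by (auto simp: differentiable_def)
  have "partial_deriv i (\<lambda>y. u y $ j) x = u' (axis i 1) $ j" for j
    by (rule partial_deriv_eqI[OF bounded_linear.has_derivative[OF bounded_linear_vec_nth u']])
  then show ?thesis
    using partial_deriv_eqI[OF has_derivative_specific_kinetic_energy[OF u']]
    by (simp add: inner_vec_def)
qed

text \<open>Product rule for a scalar times a flux, needed for \<open>k\<close> carried by the mass
  flux and by \<open>f\<close>, and for the pressure flux. The last sum is the derivative of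
  \<open>g\<close> along \<open>V\<close>.\<close>

lemma divergence_scaleR:
  assumes "g differentiable (at x)" "V differentiable (at x)"
  shows "divergence (\<lambda>y. g y *\<^sub>R V y) x
    = g x * divergence V x + (\<Sum>i\<in>UNIV. V x $ i * partial_deriv i g x)"
  using assms
  by (simp add: divergence_def partial_deriv_mult differentiable_vec_nth sum.distrib
      sum_distrib_left mult.commute)

text \<open>Because the contraction is with the first index, the product rule puts the divergence on
  \<open>a\<close> and leaves the derivative of \<open>b\<close> along \<open>a\<close>. The first
  term is the one that the continuity equation later removes.\<close>

lemma tensor_divergence_tensor_product_nth:
  assumes "a differentiable (at x)" "b differentiable (at x)"
  shows "tensor_divergence (\<lambda>y. tensor_product (a y) (b y)) x $ j
    = divergence a x * b x $ j + (\<Sum>i\<in>UNIV. a x $ i * partial_deriv i (\<lambda>y. b y $ j) x)"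
  using assms
  by (simp add: tensor_divergence_def tensor_product_def divergence_def partial_deriv_mult
      differentiable_vec_nth sum.distrib sum_distrib_right)

lemma tensor_divergence_add:
  fixes T S :: "real^'n \<Rightarrow> real^'n^'n"
  assumes "T differentiable (at x)" "S differentiable (at x)"
  shows "tensor_divergence (\<lambda>y. T y + S y) x = tensor_divergence T x + tensor_divergence S x"
proof -
  have "(\<lambda>y. A y $ i $ j) differentiable (at x)"
    if "A differentiable (at x)" for A :: "real^'n \<Rightarrow> real^'n^'n" and i j
    using that bounded_linear.has_derivative[OF bounded_linear_compose[OF
          bounded_linear_vec_nth bounded_linear_vec_nth]]
    unfolding differentiable_def by blast
  then show ?thesis
    using assms by (simp add: tensor_divergence_def vec_eq_iff partial_deriv_add sum.distrib)
qed

text \<open>Off the diagonal the entries vanish identically, so only \<open>i = j\<close> survives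
  and the pressure tensor acts as a gradient.\<close>

lemma tensor_divergence_scaleR_mat_1_nth:
  fixes p :: "real^'n \<Rightarrow> real"
  shows "tensor_divergence (\<lambda>y. p y *\<^sub>R mat 1) x $ j = partial_deriv j p x"
proof -
  have "partial_deriv i (\<lambda>y. (p y *\<^sub>R mat 1 :: real^'n^'n) $ i $ j) x
      = (if i = j then partial_deriv j p x else 0)" for i :: 'n
    by (simp add: mat_def partial_deriv_const)
  then show ?thesis by (simp add: tensor_divergence_def)
qed

text \<open>A bilinear map between finite-dimensional spaces is bounded, hence obeys the product
  rule. This lets \<open>tensor_divergence_add\<close> split the momentum flux.\<close>

lemma differentiable_tensor_product:
  fixes a b :: "'a::real_normed_vector \<Rightarrow> real^'n"
  assumes "a differentiable (at x)" "b differentiable (at x)"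
  shows "(\<lambda>y. tensor_product (a y) (b y)) differentiable (at x)"
proof -
  have "bounded_bilinear (tensor_product :: real^'n \<Rightarrow> real^'n \<Rightarrow> real^'n^'n)"
    by (simp add: bilinear_conv_bounded_bilinear[symmetric] bilinear_def linear_iff
        tensor_product_def vec_eq_iff algebra_simps)
  then show ?thesis
    using assms bounded_bilinear.FDERIV unfolding differentiable_def by blast
qed

theorem mainTheorem4:
  fixes \<Omega> :: "(real \<times> (real^'n)) set"
    and \<rho> p :: "real \<Rightarrow> real^'n \<Rightarrow> real"
    and u f :: "real \<Rightarrow> real^'n \<Rightarrow> real^'n"
    and k :: "real \<Rightarrow> real^'n \<Rightarrow> real"
  assumes "open \<Omega>"
    and "smooth_on \<Omega> (\<lambda>(t, x). \<rho> t x)"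
    and "smooth_on \<Omega> (\<lambda>(t, x). p t x)"
    and "smooth_on \<Omega> (\<lambda>(t, x). u t x)"
    and "smooth_on \<Omega> (\<lambda>(t, x). f t x)"
    and continuity: "\<And>t x. (t, x) \<in> \<Omega> \<Longrightarrow>
      deriv (\<lambda>s. \<rho> s x) t + divergence (\<lambda>y. \<rho> t y *\<^sub>R u t y) x = divergence (\<lambda>y. f t y) x"
    and momentum: "\<And>t x. (t, x) \<in> \<Omega> \<Longrightarrow>
      vector_derivative (\<lambda>s. \<rho> s x *\<^sub>R u s x) (at t)
        + tensor_divergence
            (\<lambda>y. tensor_product (\<rho> t y *\<^sub>R u t y) (u t y) + p t y *\<^sub>R mat 1) x
      = tensor_divergence (\<lambda>y. tensor_product (f t y) (u t y)) x"
    and k_eq: "\<And>t x. k t x = specific_kinetic_energy (u t x)"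
  shows "\<forall>(t, x)\<in>\<Omega>.
      deriv (\<lambda>s. \<rho> s x * k s x) t
        + divergence (\<lambda>y. k t y *\<^sub>R (\<rho> t y *\<^sub>R u t y)) x
        + divergence (\<lambda>y. p t y *\<^sub>R u t y) x
        - p t x * divergence (\<lambda>y. u t y) x
      = divergence (\<lambda>y. k t y *\<^sub>R f t y) x"
proof (safe)
  fix t x
  assume tx: "(t, x) \<in> \<Omega>"
  \<comment> \<open>The facts come in the order \<rho>, p, u, f; index 1 below selects \<rho> and
    index 3 selects u.\<close>
  note diff = assms(2-5)[THEN smooth_on_imp_differentiable, OF tx]
  note [simp] = diff[THEN differentiable_section_snd]
  note time = diff[THEN differentiable_section_fst]
  let ?\<rho>\<^sub>t = "deriv (\<lambda>s. \<rho> s x) t" and ?u\<^sub>t = "vector_derivative (\<lambda>s. u s x) (at t)"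
  let ?m = "\<lambda>y. \<rho> t y *\<^sub>R u t y"
  have [simp]: "?m differentiable (at x)"
    by (intro differentiable_scaleR) simp_all
  have k: "k s y = specific_kinetic_energy (u s y)" for s y
    by (rule k_eq)
  have \<rho>\<^sub>t: "((\<lambda>s. \<rho> s x) has_vector_derivative ?\<rho>\<^sub>t) (at t)"
    using time(1) real_differentiable_def[of "\<lambda>s. \<rho> s x"]
    by (metis DERIV_imp_deriv has_real_derivative_iff_has_vector_derivative)
  have u\<^sub>t: "((\<lambda>s. u s x) has_vector_derivative ?u\<^sub>t) (at t)"
    using time(3) vector_derivative_works by blast
  have m\<^sub>t: "vector_derivative (\<lambda>s. \<rho> s x *\<^sub>R u s x) (at t) = \<rho> t x *\<^sub>R ?u\<^sub>t + ?\<rho>\<^sub>t *\<^sub>R u t x"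
    by (rule vector_derivative_at has_vector_derivative_scaleR)+
      (simp_all add: \<rho>\<^sub>t u\<^sub>t has_real_derivative_iff_has_vector_derivative)
  have k\<^sub>t: "((\<lambda>s. k s x) has_real_derivative u t x \<bullet> ?u\<^sub>t) (at t)"
    using has_derivative_specific_kinetic_energy[OF u\<^sub>t[unfolded has_vector_derivative_def]]
    by (simp add: k has_field_derivative_def mult_commute_abs)
  have \<rho>k\<^sub>t: "deriv (\<lambda>s. \<rho> s x * k s x) t = ?\<rho>\<^sub>t * k t x + \<rho> t x * (u t x \<bullet> ?u\<^sub>t)"
    using \<rho>\<^sub>t k\<^sub>t
    by (intro DERIV_imp_deriv)
      (auto simp: has_real_derivative_iff_has_vector_derivative[symmetric]
        intro!: derivative_eq_intros)
  have k_diff [simp]: "k t differentiable (at x)"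
    using has_derivative_specific_kinetic_energy[of "u t"] diff(3)[THEN differentiable_section_snd]
    unfolding differentiable_def k[abs_def] by blast
  have k_partial: "partial_deriv i (k t) x
      = (\<Sum>j\<in>UNIV. u t x $ j * partial_deriv i (\<lambda>y. u t y $ j) x)" for i
    unfolding k[abs_def] by (simp add: partial_deriv_specific_kinetic_energy)
  \<comment> \<open>Transport of \<open>k\<close> along a vector is \<open>u\<close> contracted with
    the transport of \<open>u\<close> along it, after exchanging the two sums. The vector
    \<open>a\<close> stays arbitrary since both the mass flux and \<open>f\<close> will take its
    place.\<close>
  have k_flux: "(\<Sum>i\<in>UNIV. a $ i * partial_deriv i (k t) x)
      = (\<Sum>j\<in>UNIV. u t x $ j * (\<Sum>i\<in>UNIV. a $ i * partial_deriv i (\<lambda>y. u t y $ j) x))" for a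
    unfolding k_partial sum_distrib_left
    by (subst sum.swap) (simp add: mult.left_commute)

  have "\<rho> t x * ?u\<^sub>t $ j + (\<Sum>i\<in>UNIV. ?m x $ i * partial_deriv i (\<lambda>y. u t y $ j) x)
      + partial_deriv j (p t) x
      = (\<Sum>i\<in>UNIV. f t x $ i * partial_deriv i (\<lambda>y. u t y $ j) x)" (is "?L j = ?R j") for j
  proof -
    have "tensor_divergence (\<lambda>y. tensor_product (?m y) (u t y) + p t y *\<^sub>R mat 1) x
        = tensor_divergence (\<lambda>y. tensor_product (?m y) (u t y)) x
          + tensor_divergence (\<lambda>y. p t y *\<^sub>R mat 1) x"
      by (intro tensor_divergence_add differentiable_tensor_product differentiable_scaleR) simp_all
    then have "\<rho> t x * ?u\<^sub>t $ j + ?\<rho>\<^sub>t * u t x $ j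
        + (divergence ?m x * u t x $ j + (\<Sum>i\<in>UNIV. ?m x $ i * partial_deriv i (\<lambda>y. u t y $ j) x)
          + partial_deriv j (p t) x)
        = divergence (f t) x * u t x $ j + ?R j"
      using arg_cong[OF momentum[OF tx], of "\<lambda>v. v $ j"]
      by (simp add: m\<^sub>t tensor_divergence_tensor_product_nth tensor_divergence_scaleR_mat_1_nth)
    \<comment> \<open>This rewrites the term with div f so that it cancels
      \<open>?\<rho>\<^sub>t\<close> and the divergence of \<open>?m\<close> on the left.\<close>
    moreover have "divergence (f t) x * u t x $ j = (?\<rho>\<^sub>t + divergence ?m x) * u t x $ j"
      using continuity[OF tx] by simp
    ultimately show ?thesis by (simp only: distrib_right)
  qed
  then have "(\<Sum>j\<in>UNIV. u t x $ j * ?L j) = (\<Sum>j\<in>UNIV. u t x $ j * ?R j)"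
    by simp
  then have "\<rho> t x * (u t x \<bullet> ?u\<^sub>t) + (\<Sum>i\<in>UNIV. ?m x $ i * partial_deriv i (k t) x)
      + (\<Sum>j\<in>UNIV. u t x $ j * partial_deriv j (p t) x)
      = (\<Sum>i\<in>UNIV. f t x $ i * partial_deriv i (k t) x)"
    unfolding k_flux
    \<comment> \<open>Blocking \<open>vector_scaleR_component\<close> keeps each component of
      \<open>?m x\<close> as a single factor.\<close>
    by (simp add: inner_vec_def distrib_left sum.distrib sum_distrib_left mult.left_commute
        del: vector_scaleR_component)
  \<comment> \<open>These are the terms missing from the product rules for the time derivative of
    \<rho>k and for the divergences of \<open>k\<close> times \<open>?m\<close> and \<open>k\<close>
    times \<open>f\<close>.\<close>
  moreover have "k t x * (?\<rho>\<^sub>t + divergence ?m x) = k t x * divergence (f t) x"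
    using continuity[OF tx] by simp
  moreover have "divergence (\<lambda>y. k t y *\<^sub>R ?m y) x
      = k t x * divergence ?m x + (\<Sum>i\<in>UNIV. ?m x $ i * partial_deriv i (k t) x)"
    by (rule divergence_scaleR) simp_all
  ultimately show "deriv (\<lambda>s. \<rho> s x * k s x) t
        + divergence (\<lambda>y. k t y *\<^sub>R ?m y) x
        + divergence (\<lambda>y. p t y *\<^sub>R u t y) x
        - p t x * divergence (\<lambda>y. u t y) x
      = divergence (\<lambda>y. k t y *\<^sub>R f t y) x"
    \<comment> \<open>For the pressure, div(p u) - p div u is u contracted with the gradient of p,
      which is the pressure term of the contracted momentum equation.\<close>
    unfolding \<rho>k\<^sub>t by (simp add: divergence_scaleR algebra_simps del: vector_scaleR_component)
qed

end
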